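(* Let $\mathbb{E}_1,\mathbb{E}_2$ be Euclidean spaces, let $\{0\}\subsetneq K\subset\mathbb{E}_2$ be a closed, convex, pointed cone and let $F:\mathbb{E}_1\to\mathbb{E}_2^\bullet$ be proper. If $K\text{-}\mathrm{epi}\,F=\overline{\mathrm{conv}}(\mathrm{gph}\,F)$, then $F$ cannot have both an affine $K$-majorant on its domain and an affine $K$-minorant.
   Context: A Euclidean space is a finite-dimensional real inner product space. A cone is a nonempty set $K$ with $\lambda x\in K$ for all $\lambda\ge0$, $x\in K$; it is pointed if $K\cap(-K)=\{0\}$. $\mathbb{E}_2^\bullet:=\mathbb{E}_2\cup\{+\infty_\bullet\}$ with a formal largest element $+\infty_\bullet$; $\mathrm{dom}\,F:=\{x : F(x)\in\mathbb{E}_2\}$, $\mathrm{gph}\,F:=\{(x,F(x)) : x\in\mathrm{dom}\,F\}$, $K\text{-}\mathrm{epi}\,F:=\{(x,y)\in\mathrm{dom}\,F\times\mathbb{E}_2 : y-F(x)\in K\}$, and $F$ is proper if $\mathrm{dom}\,F\ne\emptyset$. $\overline{\mathrm{conv}}$ is the closed convex hull. A function $G:\mathbb{E}_1\to\mathbb{E}_2$ is a $K$-majorant of $F$ on its domain if $G(x)-F(x)\in K$ for all $x\in\mathrm{dom}\,F$, and a $K$-minorant of $F$ if $F(x)-G(x)\in K$ for all $x\in\mathrm{dom}\,F$; it is affine if it is of the form linear plus constant. *)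

theory Defs
  imports "HOL-Analysis.Analysis"
begin

text \<open>
  A Euclidean space is a finite-dimensional real inner product space, rendered as a type of class
  \<^class>\<open>real_inner\<close> whose universe is finite-dimensional. The library class
  \<^class>\<open>euclidean_space\<close> requires a nonempty basis and so excludes dimension zero.
\<close>

definition finite_dimensional :: "'a::real_vector set \<Rightarrow> bool" where
  "finite_dimensional S \<longleftrightarrow> (\<exists>B. finite B \<and> span B = S)"

lemma finite_dimensional_euclidean_space: "finite_dimensional (UNIV :: 'a::euclidean_space set)"
  unfolding finite_dimensional_def using finite_Basis span_Basis by blast

definition pointed :: "'a::real_vector set \<Rightarrow> bool" where
  "pointed K \<longleftrightarrow> K \<inter> uminus ` K = {0}"

text \<open>
  A function into a space extended by a formal largest element is a map
  \<open>F :: 'a \<Rightarrow> 'b option\<close>, where \<^term>\<open>None\<close> is the added element. Its domain and graph are then the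
  library's \<^const>\<open>dom\<close> and \<^const>\<open>Map.graph\<close>.
\<close>

definition proper :: "('a \<Rightarrow> 'b option) \<Rightarrow> bool" where
  "proper F \<longleftrightarrow> dom F \<noteq> {}"

definition K_epi :: "'b::real_vector set \<Rightarrow> ('a \<Rightarrow> 'b option) \<Rightarrow> ('a \<times> 'b) set" where
  "K_epi K F = {(x, y). x \<in> dom F \<and> y - the (F x) \<in> K}"

definition K_majorant :: "'b::real_vector set \<Rightarrow> ('a \<Rightarrow> 'b option) \<Rightarrow> ('a \<Rightarrow> 'b) \<Rightarrow> bool" where
  "K_majorant K F G \<longleftrightarrow> (\<forall>x\<in>dom F. G x - the (F x) \<in> K)"

definition K_minorant :: "'b::real_vector set \<Rightarrow> ('a \<Rightarrow> 'b option) \<Rightarrow> ('a \<Rightarrow> 'b) \<Rightarrow> bool" where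
  "K_minorant K F G \<longleftrightarrow> (\<forall>x\<in>dom F. the (F x) - G x \<in> K)"

definition affine_map :: "('a::real_vector \<Rightarrow> 'b::real_vector) \<Rightarrow> bool" where
  "affine_map G \<longleftrightarrow> (\<exists>L b. linear L \<and> G = (\<lambda>x. L x + b))"

end

theory Submission
  imports Defs
begin

text \<open>
  Let \<open>G\<close> be an affine \<open>K\<close>-majorant. The set of all \<open>(x, y)\<close> with
  \<open>G x - y \<in> K\<close> contains the graph of \<open>F\<close>. It is convex because \<open>G\<close> is affine and \<open>K\<close> convex, and
  closed because \<open>G\<close> is continuous and \<open>K\<close> closed. Hence it contains the closed convex hull of the
  graph, that is, the whole \<open>K\<close>-epigraph. Now fix \<open>x\<close> in the domain and a nonzero \<open>k \<in> K\<close>. The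
  \<open>K\<close>-epigraph contains the vertical ray \<open>(x, F x + t k)\<close>, \<open>t \<ge> 0\<close>, so \<open>K\<close> contains the ray
  \<open>G x - F x - t k\<close>. A closed cone contains the direction of every ray in it
  (\<open>closed_cone_contains_ray_direction\<close>), so both \<open>k\<close> and \<open>- k\<close> lie in \<open>K\<close>, against pointedness.

  Continuity of \<open>G\<close> is where the finite dimension of its source enters
  (\<open>linear_continuous_finite_dimensional\<close>).
\<close>

text \<open>
  Over a finite orthogonal spanning set \<open>C\<close>, a linear map is the finite sum of the functions
  \<open>x \<mapsto> ((x \<bullet> c) / (c \<bullet> c)) L c\<close>, each of which is continuous.
\<close>
lemma linear_continuous_finite_dimensional:
  fixes L :: "'a::real_inner \<Rightarrow> 'b::real_normed_vector"
  assumes "finite_dimensional (UNIV :: 'a set)" and L: "linear L"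
  shows "continuous_on S L"
proof -
  obtain B :: "'a set" where "finite B" "span B = UNIV"
    using assms(1) unfolding finite_dimensional_def by blast
  then obtain C :: "'a set"
    where C: "finite C" "span C = UNIV" "pairwise orthogonal C"
    using basis_orthogonal[of B] by metis
  have expansion: "x = (\<Sum>c\<in>C. (x \<bullet> c / (c \<bullet> c)) *\<^sub>R c)" (is "x = ?p x") for x
  proof -
    have "orthogonal (x - ?p x) d" if "d \<in> C" for d
    proof -
      \<comment> \<open>\<open>C\<close> may contain \<open>0\<close>: its term in the sum and \<open>x \<bullet> 0\<close> are both zero.\<close>
      have "?p x \<bullet> d = (\<Sum>c\<in>C. if c = d then x \<bullet> d else 0)"
        unfolding inner_sum_left using C(3) that
        by (intro sum.cong) (auto simp: pairwise_def orthogonal_def)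
      then show ?thesis
        using C(1) that by (simp add: orthogonal_def inner_diff_left)
    qed
    then have "orthogonal (x - ?p x) (x - ?p x)"
      using orthogonal_to_span[of "x - ?p x" C] C(2) by simp
    then show ?thesis
      by (simp add: orthogonal_def)
  qed
  have "L = (\<lambda>x. \<Sum>c\<in>C. (x \<bullet> c / (c \<bullet> c)) *\<^sub>R L c)"
  proof
    fix x
    have "L x = L (\<Sum>c\<in>C. (x \<bullet> c / (c \<bullet> c)) *\<^sub>R c)"
      using expansion[of x] by (rule arg_cong)
    also have "\<dots> = (\<Sum>c\<in>C. (x \<bullet> c / (c \<bullet> c)) *\<^sub>R L c)"
      by (simp add: linear_sum[OF L] linear_scale[OF L])
    finally show "L x = (\<Sum>c\<in>C. (x \<bullet> c / (c \<bullet> c)) *\<^sub>R L c)" .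
  qed
  moreover have "continuous_on S (\<lambda>x. \<Sum>c\<in>C. (x \<bullet> c / (c \<bullet> c)) *\<^sub>R L c)"
    unfolding divide_inverse by (intro continuous_intros)
  ultimately show ?thesis
    by metis
qed

text \<open>
  Scaling the point \<open>a + t v\<close> by \<open>1 / t\<close> stays in the cone and tends to \<open>v\<close> as \<open>t\<close> grows.
\<close>
lemma closed_cone_contains_ray_direction:
  fixes K :: "'b::real_normed_vector set"
  assumes "closed K" and "cone K" and ray: "\<And>t. t \<ge> 0 \<Longrightarrow> a + t *\<^sub>R v \<in> K"
  shows "v \<in> K"
proof (rule closed_sequentially[OF \<open>closed K\<close>])
  fix n
  have "inverse (real (Suc n)) *\<^sub>R (a + real (Suc n) *\<^sub>R v) \<in> K"
    using \<open>cone K\<close> ray[of "real (Suc n)"] unfolding cone_def by simp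
  then show "inverse (real (Suc n)) *\<^sub>R a + v \<in> K"
    by (simp add: scaleR_add_right del: of_nat_Suc)
next
  have "(\<lambda>n. inverse (real (Suc n)) *\<^sub>R a + v) \<longlonglongrightarrow> 0 *\<^sub>R a + v"
    by (intro tendsto_intros LIMSEQ_inverse_real_of_nat)
  then show "(\<lambda>n. inverse (real (Suc n)) *\<^sub>R a + v) \<longlonglongrightarrow> v"
    by simp
qed

text \<open>
  The set of points \<open>K\<close>-below \<open>G\<close> is the preimage of \<open>K\<close> under an affine continuous map of the
  pair, so it is closed and convex, and it contains the graph.
\<close>
lemma closed_convex_hull_graph_below_affine_majorant:
  fixes K :: "'b::real_inner set" and F :: "'a::real_inner \<Rightarrow> 'b option"
  assumes "finite_dimensional (UNIV :: 'a set)" and "closed K" and "convex K"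
    and "affine_map G" and "K_majorant K F G"
  shows "closure (convex hull (Map.graph F)) \<subseteq> {(x, y). G x - y \<in> K}"
proof -
  obtain L b where L: "linear L" and G: "G = (\<lambda>x. L x + b)"
    using \<open>affine_map G\<close> unfolding affine_map_def by blast
  let ?h = "\<lambda>p. L (fst p) - snd p"
  have below: "{(x, y). G x - y \<in> K} = ?h -` ((+) (- b) ` K)"
    unfolding G by (force simp: algebra_simps image_iff)
  have "linear ?h"
    by (rule linearI) (simp_all add: linear_add[OF L] linear_scale[OF L] algebra_simps)
  then have "convex {(x, y). G x - y \<in> K}"
    unfolding below using \<open>convex K\<close> by (intro convex_linear_vimage[OF _ convex_translation])
  moreover have "continuous_on UNIV ?h"
    by (intro continuous_on_diff continuous_on_fst continuous_on_snd continuous_on_id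
        continuous_on_compose2[OF linear_continuous_finite_dimensional[OF assms(1) L, of UNIV]])
      simp
  then have "closed {(x, y). G x - y \<in> K}"
    unfolding below using \<open>closed K\<close> by (intro closed_vimage[OF closed_translation])
  moreover have "Map.graph F \<subseteq> {(x, y). G x - y \<in> K}"
    using \<open>K_majorant K F G\<close> unfolding K_majorant_def Map.graph_def by force
  ultimately show ?thesis
    by (intro closure_minimal hull_minimal)
qed

theorem proposition40:
  fixes K :: "'b::real_inner set"
    and F :: "'a::real_inner \<Rightarrow> 'b option"
  assumes "finite_dimensional (UNIV :: 'a set)" and "finite_dimensional (UNIV :: 'b set)"
    and "{0} \<subset> K" and "closed K" and "convex K" and "cone K" and "pointed K"
    and "proper F"
    and "K_epi K F = closure (convex hull (Map.graph F))"
  shows "\<not> ((\<exists>G. affine_map G \<and> K_majorant K F G) \<and> (\<exists>H. affine_map H \<and> K_minorant K F H))"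
proof
  assume "(\<exists>G. affine_map G \<and> K_majorant K F G) \<and> (\<exists>H. affine_map H \<and> K_minorant K F H)"
  then obtain G where "affine_map G" "K_majorant K F G"
    by blast
  then have epi_below: "K_epi K F \<subseteq> {(x, y). G x - y \<in> K}"
    using closed_convex_hull_graph_below_affine_majorant assms by metis
  obtain x where "x \<in> dom F"
    using \<open>proper F\<close> unfolding proper_def by blast
  obtain k where "k \<in> K" "k \<noteq> 0"
    using \<open>{0} \<subset> K\<close> by blast
  have "- k \<in> K"
  proof (rule closed_cone_contains_ray_direction[OF \<open>closed K\<close> \<open>cone K\<close>])
    fix t :: real
    assume "t \<ge> 0"
    then have "(x, the (F x) + t *\<^sub>R k) \<in> K_epi K F"
      using \<open>x \<in> dom F\<close> \<open>k \<in> K\<close> \<open>cone K\<close> unfolding K_epi_def cone_def by simp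
    then have "G x - (the (F x) + t *\<^sub>R k) \<in> K"
      using epi_below by blast
    then show "(G x - the (F x)) + t *\<^sub>R (- k) \<in> K"
      by (simp add: algebra_simps)
  qed
  then have "k \<in> K \<inter> uminus ` K"
    using \<open>k \<in> K\<close> by (auto intro: image_eqI[of _ _ "- k"])
  then show False
    using \<open>pointed K\<close> \<open>k \<noteq> 0\<close> unfolding pointed_def by blast
qed

end
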